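(* Let $G$ be a profinite group. The following conditions are equivalent: (1) $G$ is covered by countably many abelian subgroups, that is, $G$ is the union of a countable family of abelian subgroups; (2) the commutator subgroup $G'$ is finite; (3) $G$ is central-by-finite, that is, $G/Z(G)$ is finite.
   Context: For a profinite group $G$, the commutator of $x,y\in G$ is $[x,y]=x^{-1}y^{-1}xy$, and $G'$ denotes the closed subgroup of $G$ generated by all commutators $[x,y]$, $x,y\in G$. $Z(G)$ is the center of $G$. "Countably many" allows finitely many. *)

theory Defs
  imports "HOL-Analysis.Analysis" "HOL-Algebra.Coset" "HOL-Algebra.Generated_Groups"
begin

locale topological_group = group G for G :: "('a, 'b) monoid_scheme" (structure) +
  fixes T :: "'a topology"
  assumes topspace_eq: "topspace T = carrier G"
    and continuous_mult: "continuous_map (prod_topology T T) T (\<lambda>(x, y). x \<otimes> y)"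
    and continuous_inv: "continuous_map T T (\<lambda>x. inv x)"

definition totally_disconnected_space :: "'a topology \<Rightarrow> bool" where
  "totally_disconnected_space U \<longleftrightarrow>
     (\<forall>S. connectedin U S \<longrightarrow> S = {} \<or> (\<exists>x. S = {x}))"

locale profinite_group = topological_group +
  assumes compact: "compact_space T"
    and Hausdorff: "Hausdorff_space T"
    and totally_disconnected: "totally_disconnected_space T"

definition group_center :: "('a, 'b) monoid_scheme \<Rightarrow> 'a set" where
  "group_center G = {z \<in> carrier G. \<forall>g \<in> carrier G. z \<otimes>\<^bsub>G\<^esub> g = g \<otimes>\<^bsub>G\<^esub> z}"

definition commutator :: "('a, 'b) monoid_scheme \<Rightarrow> 'a \<Rightarrow> 'a \<Rightarrow> 'a" where
  "commutator G x y = inv\<^bsub>G\<^esub> x \<otimes>\<^bsub>G\<^esub> inv\<^bsub>G\<^esub> y \<otimes>\<^bsub>G\<^esub> x \<otimes>\<^bsub>G\<^esub> y"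

definition closed_subgroup_generated ::
  "('a, 'b) monoid_scheme \<Rightarrow> 'a topology \<Rightarrow> 'a set \<Rightarrow> 'a set" where
  "closed_subgroup_generated G T S = \<Inter>{H. subgroup H G \<and> closedin T H \<and> S \<subseteq> H}"

definition commutator_subgroup :: "('a, 'b) monoid_scheme \<Rightarrow> 'a topology \<Rightarrow> 'a set" where
  "commutator_subgroup G T =
     closed_subgroup_generated G T {commutator G x y | x y. x \<in> carrier G \<and> y \<in> carrier G}"

definition abelian_subgroup :: "'a set \<Rightarrow> ('a, 'b) monoid_scheme \<Rightarrow> bool" where
  "abelian_subgroup H G \<longleftrightarrow> subgroup H G \<and> comm_group (G\<lparr>carrier := H\<rparr>)"

text \<open>The covering subgroups are abstract subgroups; they need not be closed.\<close>

definition covered_by_countably_many_abelian_subgroups :: "('a, 'b) monoid_scheme \<Rightarrow> bool" where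
  "covered_by_countably_many_abelian_subgroups G \<longleftrightarrow>
     (\<exists>\<F>. countable \<F> \<and> (\<forall>H \<in> \<F>. abelian_subgroup H G) \<and> \<Union>\<F> = carrier G)"

lemma group_centerD:
  assumes "z \<in> group_center G"
  shows "z \<in> carrier G" and "g \<in> carrier G \<Longrightarrow> z \<otimes>\<^bsub>G\<^esub> g = g \<otimes>\<^bsub>G\<^esub> z"
  using assms unfolding group_center_def by blast+

lemma group_centerI:
  assumes "z \<in> carrier G" and "\<And>g. g \<in> carrier G \<Longrightarrow> z \<otimes>\<^bsub>G\<^esub> g = g \<otimes>\<^bsub>G\<^esub> z"
  shows "z \<in> group_center G"
  using assms unfolding group_center_def by blast

lemma (in group) group_center_normal: "group_center G \<lhd> G"
proof -
  have "subgroup (group_center G) G"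
  proof (rule subgroupI)
    show "group_center G \<subseteq> carrier G"
      by (auto dest: group_centerD(1))
    have "\<one> \<in> group_center G"
      by (rule group_centerI) auto
    then show "group_center G \<noteq> {}" by blast
  next
    fix a assume a: "a \<in> group_center G"
    note ac = group_centerD(1)[OF a]
    show "inv a \<in> group_center G"
    proof (rule group_centerI)
      fix g assume g: "g \<in> carrier G"
      have "inv (a \<otimes> inv g) = inv (inv g \<otimes> a)"
        by (rule arg_cong[OF group_centerD(2)[OF a]]) (rule inv_closed[OF g])
      then show "inv a \<otimes> g = g \<otimes> inv a"
        using ac g by (simp add: inv_mult_group)
    qed (use ac in simp)
  next
    fix a b assume a: "a \<in> group_center G" and b: "b \<in> group_center G"
    note ac = group_centerD(1)[OF a] and bc = group_centerD(1)[OF b]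
    show "a \<otimes> b \<in> group_center G"
    proof (rule group_centerI)
      fix g assume g: "g \<in> carrier G"
      have "a \<otimes> b \<otimes> g = a \<otimes> (b \<otimes> g)"
        using ac bc g by (rule m_assoc)
      also have "\<dots> = a \<otimes> (g \<otimes> b)"
        by (simp only: group_centerD(2)[OF b g])
      also have "\<dots> = a \<otimes> g \<otimes> b"
        using ac g bc by (rule m_assoc[symmetric])
      also have "\<dots> = g \<otimes> a \<otimes> b"
        by (simp only: group_centerD(2)[OF a g])
      also have "\<dots> = g \<otimes> (a \<otimes> b)"
        using g ac bc by (rule m_assoc)
      finally show "a \<otimes> b \<otimes> g = g \<otimes> (a \<otimes> b)" .
    qed (use ac bc in simp)
  qed
  moreover have "x \<otimes> h \<otimes> inv x \<in> group_center G"
    if x: "x \<in> carrier G" and h: "h \<in> group_center G" for x h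
  proof -
    have "x \<otimes> h \<otimes> inv x = h \<otimes> x \<otimes> inv x"
      by (simp only: group_centerD(2)[OF h x])
    also have "\<dots> = h"
      using x group_centerD(1)[OF h] by (simp add: m_assoc)
    finally show ?thesis using h by (simp only:)
  qed
  ultimately show ?thesis
    by (intro normal_invI)
qed

lemma (in topological_group) commutator_subgroup_closed_subgroup:
  shows "subgroup (commutator_subgroup G T) G" and "closedin T (commutator_subgroup G T)"
proof -
  let ?S = "{commutator G x y | x y. x \<in> carrier G \<and> y \<in> carrier G}"
  let ?A = "{H. subgroup H G \<and> closedin T H \<and> ?S \<subseteq> H}"
  have "carrier G \<in> ?A"
    using subgroup_self closedin_topspace[of T] by (auto simp: commutator_def topspace_eq)
  then have ne: "?A \<noteq> {}" by blast
  show "subgroup (commutator_subgroup G T) G"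
    unfolding commutator_subgroup_def closed_subgroup_generated_def
    by (rule subgroups_Inter[OF _ ne]) simp
  show "closedin T (commutator_subgroup G T)"
    unfolding commutator_subgroup_def closed_subgroup_generated_def
    by (rule closedin_Inter[OF ne]) simp
qed

end

theory Submission
  imports "HOL-Algebra.Multiplicative_Group" Defs
begin

text \<open>
Everything is compared with the center $Z(G)$ being of finite index. In a compact group an open
subgroup has finite index, so to reach this condition from either of the other two it is enough to
find a neighborhood of $1$ consisting of central elements.

If $G$ is covered by countably many abelian subgroups $H$, pass to the double centralizers
$C(C(H))$, which are closed and still abelian. The Baire category theorem shows that the open ones
among them have dense union. Finitely many open ones then suffice to generate $G$ (one of them and,
for each of its finitely many cosets, one meeting that coset), and their intersection is open and
central (\<open>open_center_if_countable_abelian_cover\<close>). Conversely, when $Z(G)$ has finite index, the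
subgroups $C(C(\{x\}))$ are abelian, cover $G$, and are finite in number
(\<open>countable_abelian_cover_if_central_by_finite\<close>).

If $G'$ is finite, then $1$ is isolated among the commutators, and the tube lemma, applied to the
commutator map near $G \times \{1\}$, produces a neighborhood of $1$ that commutes with all of $G$
(\<open>open_center_if_finite_commutators\<close>). The converse is Schur's theorem
(\<open>finite_generate_commutators_if_central_by_finite\<close>): there are only finitely many commutators,
and long products of them can be shortened, because sufficiently high powers of a commutator are
products of fewer commutators. The resulting finite group is closed, hence equal to $G'$.
\<close>

section \<open>Centralizers and the abelian subgroups they produce\<close>

definition centralizer :: "('a, 'b) monoid_scheme \<Rightarrow> 'a set \<Rightarrow> 'a set" where
  "centralizer G S = {g \<in> carrier G. \<forall>s \<in> S. g \<otimes>\<^bsub>G\<^esub> s = s \<otimes>\<^bsub>G\<^esub> g}"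

lemma (in group) subgroup_group_center: "subgroup (group_center G) G"
  by (rule normal_imp_subgroup[OF group_center_normal])

lemma (in group) subgroup_centralizer:
  assumes "S \<subseteq> carrier G"
  shows "subgroup (centralizer G S) G"
proof (rule subgroupI)
  show "centralizer G S \<noteq> {}"
    using assms by (auto simp: centralizer_def intro!: exI[of _ \<one>])
next
  fix a assume a: "a \<in> centralizer G S"
  then have ac: "a \<in> carrier G" by (simp add: centralizer_def)
  have "inv a \<otimes> s = s \<otimes> inv a" if s: "s \<in> S" for s
  proof -
    have sc: "s \<in> carrier G" using s assms by blast
    have "a \<otimes> s = s \<otimes> a" using a s by (simp add: centralizer_def)
    then have "s = inv a \<otimes> (s \<otimes> a)" using ac sc by (simp add: inv_solve_left)
    then have "s = inv a \<otimes> s \<otimes> a" using ac sc by (simp add: m_assoc)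
    then show ?thesis using ac sc by (metis inv_closed inv_solve_right m_closed)
  qed
  then show "inv a \<in> centralizer G S" using ac by (simp add: centralizer_def)
next
  fix a b assume a: "a \<in> centralizer G S" and b: "b \<in> centralizer G S"
  have ac: "a \<in> carrier G" and bc: "b \<in> carrier G"
    using a b by (auto simp: centralizer_def)
  have "a \<otimes> b \<otimes> s = s \<otimes> (a \<otimes> b)" if s: "s \<in> S" for s
  proof -
    have sc: "s \<in> carrier G" using s assms by blast
    have "a \<otimes> b \<otimes> s = a \<otimes> (s \<otimes> b)"
      using b s ac bc sc by (simp add: centralizer_def m_assoc)
    also have "\<dots> = s \<otimes> (a \<otimes> b)"
      using a s ac bc sc by (simp add: centralizer_def flip: m_assoc)
    finally show ?thesis .
  qed
  then show "a \<otimes> b \<in> centralizer G S" using ac bc by (simp add: centralizer_def)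
qed (auto simp: centralizer_def)

lemma (in group) abelian_subgroupI:
  assumes "subgroup H G" and "\<And>x y. x \<in> H \<Longrightarrow> y \<in> H \<Longrightarrow> x \<otimes> y = y \<otimes> x"
  shows "Defs.abelian_subgroup H G"
proof -
  have "comm_group (G\<lparr>carrier := H\<rparr>)"
    by (rule group.group_comm_groupI[OF subgroup_imp_group[OF assms(1)]]) (simp add: assms(2))
  with assms(1) show ?thesis by (simp add: Defs.abelian_subgroup_def)
qed

lemma abelian_subgroupD:
  assumes "Defs.abelian_subgroup H G"
  shows "subgroup H G" and "x \<in> H \<Longrightarrow> y \<in> H \<Longrightarrow> x \<otimes>\<^bsub>G\<^esub> y = y \<otimes>\<^bsub>G\<^esub> x"
proof -
  show "subgroup H G" using assms by (simp add: Defs.abelian_subgroup_def)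
  have "comm_monoid (G\<lparr>carrier := H\<rparr>)"
    using assms by (simp add: Defs.abelian_subgroup_def comm_group_def)
  then show "x \<in> H \<Longrightarrow> y \<in> H \<Longrightarrow> x \<otimes>\<^bsub>G\<^esub> y = y \<otimes>\<^bsub>G\<^esub> x"
    using comm_monoid.m_comm by fastforce
qed

text \<open>If the elements of $S$ commute with each other, then $S$ lies in its centralizer; taking
centralizers reverses inclusions, so the double centralizer $C(C(S))$ lies in $C(S)$, which commutes
with it. An abelian subgroup is thereby enlarged to one of the form $C(X)$, and such subgroups have
two virtues used below: they are closed in every Hausdorff group topology, and $C(C(\{x\}))$ depends
only on the coset of $x$ modulo the center.\<close>

lemma (in group) abelian_bicentralizer:
  assumes "S \<subseteq> carrier G" and comm: "\<And>s t. s \<in> S \<Longrightarrow> t \<in> S \<Longrightarrow> s \<otimes> t = t \<otimes> s"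
  shows "Defs.abelian_subgroup (centralizer G (centralizer G S)) G"
    and "S \<subseteq> centralizer G (centralizer G S)"
proof -
  show "S \<subseteq> centralizer G (centralizer G S)"
    using assms(1) by (fastforce simp: centralizer_def)
  have "S \<subseteq> centralizer G S" using assms by (auto simp: centralizer_def)
  then have sub: "centralizer G (centralizer G S) \<subseteq> centralizer G S"
    by (auto simp: centralizer_def)
  show "Defs.abelian_subgroup (centralizer G (centralizer G S)) G"
  proof (rule abelian_subgroupI)
    show "subgroup (centralizer G (centralizer G S)) G"
      by (rule subgroup_centralizer) (auto simp: centralizer_def)
    fix x y assume "x \<in> centralizer G (centralizer G S)" "y \<in> centralizer G (centralizer G S)"
    with sub show "x \<otimes> y = y \<otimes> x" by (auto simp: centralizer_def)
  qed
qed

lemma (in group) centralizer_center_mult: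
  assumes z: "z \<in> group_center G" and x: "x \<in> carrier G"
  shows "centralizer G {z \<otimes> x} = centralizer G {x}"
proof -
  have zc: "z \<in> carrier G" using z by (rule group_centerD)
  have "g \<otimes> (z \<otimes> x) = z \<otimes> x \<otimes> g \<longleftrightarrow> g \<otimes> x = x \<otimes> g" if g: "g \<in> carrier G" for g
  proof -
    have "g \<otimes> (z \<otimes> x) = z \<otimes> (g \<otimes> x)"
      using g zc x group_centerD(2)[OF z g] by (simp flip: m_assoc)
    then show ?thesis using g zc x by (simp add: m_assoc)
  qed
  then show ?thesis by (auto simp: centralizer_def)
qed

text \<open>Functions that are invariant under multiplication by central elements factor through the cosets of
the center; the chosen representatives serve to write down the factored function.\<close>

lemma (in group) center_coset_repr:
  assumes "C \<in> rcosets (group_center G)" and "x \<in> C"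
  obtains z where "z \<in> group_center G" and "x = z \<otimes> (SOME y. y \<in> C)" and "(SOME y. y \<in> C) \<in> carrier G"
proof -
  let ?r = "SOME y. y \<in> C"
  have r: "?r \<in> C" using assms(2) by (rule someI)
  have C: "C \<subseteq> carrier G"
    using subgroup.rcosets_carrier[OF subgroup_group_center is_group assms(1)] .
  then have rc: "?r \<in> carrier G" and xc: "x \<in> carrier G" using r assms(2) by auto
  obtain c where "c \<in> carrier G" "C = group_center G #> c"
    using assms(1) by (auto simp: RCOSETS_def)
  then have "C = group_center G #> ?r"
    using repr_independence[OF _ _ subgroup_group_center] r by simp
  with assms(2) obtain z where "z \<in> group_center G" "x = z \<otimes> ?r"
    by (auto simp: r_coset_def)
  then show thesis using that rc by blast
qed

text \<open>Every $x$ lies in the abelian subgroup $C(C(\{x\}))$, and there are at most as many of these as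
cosets of the center.\<close>

lemma (in group) countable_abelian_cover_if_central_by_finite:
  assumes "finite (rcosets (group_center G))"
  shows "covered_by_countably_many_abelian_subgroups G"
proof -
  let ?B = "\<lambda>x. centralizer G (centralizer G {x})"
  let ?F = "?B ` carrier G"
  have "?B x \<in> (\<lambda>C. ?B (SOME y. y \<in> C)) ` (rcosets (group_center G))" if x: "x \<in> carrier G" for x
  proof (rule image_eqI)
    show coset: "group_center G #> x \<in> rcosets (group_center G)"
      using x subgroup.subset[OF subgroup_group_center] by (intro rcosetsI)
    have "x \<in> group_center G #> x" by (rule rcos_self[OF x subgroup_group_center])
    then show "?B x = ?B (SOME y. y \<in> group_center G #> x)"
      using center_coset_repr[OF coset] centralizer_center_mult by metis
  qed
  then have "?F \<subseteq> (\<lambda>C. ?B (SOME y. y \<in> C)) ` (rcosets (group_center G))" by blast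
  then have "finite ?F" using assms by (rule finite_subset[OF _ finite_imageI])
  moreover have ab: "Defs.abelian_subgroup (?B x) G" and mem: "x \<in> ?B x" if "x \<in> carrier G" for x
    using abelian_bicentralizer[of "{x}"] that by auto
  moreover have "\<Union>?F = carrier G"
    using mem by (auto simp: centralizer_def)
  ultimately show ?thesis
    unfolding covered_by_countably_many_abelian_subgroups_def
    by (intro exI[of _ ?F]) (auto intro: countable_finite)
qed

section \<open>Groups generated by finitely many conjugation-stable elements\<close>

lemma (in group) inv_mult_cancel:
  assumes "x \<in> carrier G" "y \<in> carrier G"
  shows "inv x \<otimes> (x \<otimes> y) = y" and "x \<otimes> (inv x \<otimes> y) = y"
  using assms by (simp_all flip: m_assoc)

definition word_product :: "('a, 'b) monoid_scheme \<Rightarrow> 'a list \<Rightarrow> 'a" where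
  "word_product G w = foldr (\<lambda>x y. x \<otimes>\<^bsub>G\<^esub> y) w \<one>\<^bsub>G\<^esub>"

lemma word_product_simps [simp]:
  "word_product G [] = \<one>\<^bsub>G\<^esub>"
  "word_product G (x # w) = x \<otimes>\<^bsub>G\<^esub> word_product G w"
  by (simp_all add: word_product_def)

lemma (in group) word_product_closed [simp]:
  "set w \<subseteq> carrier G \<Longrightarrow> word_product G w \<in> carrier G"
  by (induction w) auto

lemma (in group) word_product_append:
  "set v \<subseteq> carrier G \<Longrightarrow> set w \<subseteq> carrier G \<Longrightarrow>
    word_product G (v @ w) = word_product G v \<otimes> word_product G w"
  by (induction v) (auto simp: m_assoc)

lemma (in group) word_product_replicate:
  "x \<in> carrier G \<Longrightarrow> word_product G (replicate n x) = x [^] n"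
  by (induction n) (simp_all add: nat_pow_Suc2[unfolded nat_pow_Suc])

text \<open>An occurrence of $c$ can be moved to the left past any letter $d$ at the price of replacing $d$ by
$c^{-1} d c$, which is again a letter.\<close>

lemma (in group) pull_power_to_front:
  assumes K: "K \<subseteq> carrier G"
    and conj: "\<And>g x. g \<in> carrier G \<Longrightarrow> x \<in> K \<Longrightarrow> inv g \<otimes> x \<otimes> g \<in> K"
    and c: "c \<in> K"
  shows "set w \<subseteq> K \<Longrightarrow> k \<le> count_list w c \<Longrightarrow>
    \<exists>v. set v \<subseteq> K \<and> length v + k = length w \<and> word_product G w = c [^] k \<otimes> word_product G v"
proof (induction w arbitrary: k)
  case Nil
  then show ?case by simp
next
  case (Cons d w)
  have cc: "c \<in> carrier G" and dc: "d \<in> carrier G" and wc: "set w \<subseteq> carrier G"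
    using c K Cons.prems(1) by auto
  consider "k = 0" | k' where "d = c" "k = Suc k'" | "d \<noteq> c" by (cases k) auto
  then show ?case
  proof cases
    case 1
    then show ?thesis using Cons.prems(1) dc wc by (intro exI[of _ "d # w"]) simp
  next
    case 2
    then obtain v where v: "set v \<subseteq> K" "length v + k' = length w"
        "word_product G w = c [^] k' \<otimes> word_product G v"
      using Cons.IH[of k'] Cons.prems by auto
    have "word_product G (d # w) = c [^] k \<otimes> word_product G v"
      using 2 v cc subset_trans[OF v(1) K] nat_pow_Suc2[of c k'] by (simp flip: m_assoc)
    with 2 v show ?thesis by auto
  next
    case 3
    then obtain v where v: "set v \<subseteq> K" "length v + k = length w"
        "word_product G w = c [^] k \<otimes> word_product G v"
      using Cons.IH[of k] Cons.prems by auto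
    let ?d = "inv (c [^] k) \<otimes> d \<otimes> c [^] k"
    have "set v \<subseteq> carrier G" using v(1) K by blast
    then have "word_product G (d # w) = c [^] k \<otimes> word_product G (?d # v)"
      using v(3) cc dc by (simp add: m_assoc inv_mult_cancel)
    moreover have "?d \<in> K" using conj Cons.prems(1) cc by simp
    ultimately show ?thesis using v by (intro exI[of _ "?d # v"]) simp
  qed
qed

text \<open>A word with more than $|K| e$ letters contains some letter $c$ more than $e$ times. Collecting $e+1$
copies of it in front and rewriting $c^{e+1}$ with at most $e$ letters gives a shorter word for the
same element.\<close>

lemma (in group) word_shortening:
  assumes K: "K \<subseteq> carrier G" "finite K"
    and conj: "\<And>g x. g \<in> carrier G \<Longrightarrow> x \<in> K \<Longrightarrow> inv g \<otimes> x \<otimes> g \<in> K"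
    and pow: "\<And>c. c \<in> K \<Longrightarrow> \<exists>u. set u \<subseteq> K \<and> length u \<le> e \<and> word_product G u = c [^] Suc e"
  shows "set w \<subseteq> K \<Longrightarrow>
    \<exists>v. set v \<subseteq> K \<and> length v \<le> card K * e \<and> word_product G v = word_product G w"
proof (induction "length w" arbitrary: w rule: less_induct)
  case less
  show ?case
  proof (cases "length w \<le> card K * e")
    case True
    then show ?thesis using less.prems by blast
  next
    case False
    have "\<exists>c\<in>K. Suc e \<le> count_list w c"
    proof (rule ccontr)
      assume "\<not> ?thesis"
      then have "sum (count_list w) K \<le> card K * e"
        by (intro sum_bounded_above[where K = e, simplified]) (auto simp: not_less_eq_eq)
      then show False using False sum_count_set[OF less.prems K(2)] by simp
    qed
    then obtain c where c: "c \<in> K" "Suc e \<le> count_list w c" by blast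
    obtain v where v: "set v \<subseteq> K" "length v + Suc e = length w"
        "word_product G w = c [^] Suc e \<otimes> word_product G v"
      using pull_power_to_front[OF K(1) conj c(1) less.prems c(2)] by blast
    obtain u where u: "set u \<subseteq> K" "length u \<le> e" "word_product G u = c [^] Suc e"
      using pow[OF c(1)] by blast
    have "set u \<subseteq> carrier G" "set v \<subseteq> carrier G" using u(1) v(1) K(1) by blast+
    then have "word_product G (u @ v) = word_product G w"
      using u v by (simp add: word_product_append)
    moreover have "length (u @ v) < length w" "set (u @ v) \<subseteq> K" using u v by auto
    ultimately show ?thesis using less.hyps by metis
  qed
qed

text \<open>A form of Dietzmann's lemma. Allowing $c^{e+1}$ to be a product of $e$ elements of $K$, in place of
requiring $c^e = 1$, makes it applicable to commutators without knowing in advance that they have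
finite order.\<close>

lemma (in group) finite_generate_if_powers_shorten:
  assumes K: "K \<subseteq> carrier G" "finite K"
    and inv: "\<And>x. x \<in> K \<Longrightarrow> inv x \<in> K"
    and conj: "\<And>g x. g \<in> carrier G \<Longrightarrow> x \<in> K \<Longrightarrow> inv g \<otimes> x \<otimes> g \<in> K"
    and pow: "\<And>c. c \<in> K \<Longrightarrow> \<exists>u. set u \<subseteq> K \<and> length u \<le> e \<and> word_product G u = c [^] Suc e"
  shows "finite (generate G K)"
proof -
  have "\<exists>w. set w \<subseteq> K \<and> word_product G w = g" if "g \<in> generate G K" for g
    using that
  proof (induction rule: generate.induct)
    case one
    show ?case by (intro exI[of _ "[]"]) simp
  next
    case (incl h)
    then show ?case using K by (intro exI[of _ "[h]"]) auto
  next
    case (inv h)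
    then show ?case using K assms(3) by (intro exI[of _ "[inv h]"]) auto
  next
    case (eng g h)
    then obtain v w where "set v \<subseteq> K" "word_product G v = g" "set w \<subseteq> K" "word_product G w = h"
      by blast
    moreover from this have "set v \<subseteq> carrier G" "set w \<subseteq> carrier G" using K(1) by blast+
    ultimately show ?case by (intro exI[of _ "v @ w"]) (simp add: word_product_append)
  qed
  then have "generate G K \<subseteq> word_product G ` {w. set w \<subseteq> K \<and> length w \<le> card K * e}"
    using word_shortening[OF K conj pow] by (smt (verit, ccfv_SIG) image_eqI mem_Collect_eq subsetI)
  then show ?thesis using finite_lists_length_le[OF K(2)] by (rule finite_subset[OF _ finite_imageI])
qed

section \<open>Schur's theorem\<close>

definition commutators :: "('a, 'b) monoid_scheme \<Rightarrow> 'a set" where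
  "commutators G = {commutator G x y | x y. x \<in> carrier G \<and> y \<in> carrier G}"

lemma (in group) commutator_closed [simp]:
  "x \<in> carrier G \<Longrightarrow> y \<in> carrier G \<Longrightarrow> commutator G x y \<in> carrier G"
  by (simp add: commutator_def)

lemma (in group) commutators_subset: "commutators G \<subseteq> carrier G"
  by (auto simp: commutators_def)

text \<open>Written as $xy = yxc$, the relation $c = [x,y]$ contains no inverses, so that central factors can
simply be moved through it.\<close>

lemma (in group) commutator_eq_iff:
  assumes "x \<in> carrier G" "y \<in> carrier G" "c \<in> carrier G"
  shows "commutator G x y = c \<longleftrightarrow> x \<otimes> y = y \<otimes> (x \<otimes> c)"
proof -
  have "commutator G x y = inv (y \<otimes> x) \<otimes> (x \<otimes> y)"
    using assms by (simp add: commutator_def inv_mult_group m_assoc)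
  then show ?thesis
    using assms by (metis inv_solve_left m_assoc m_closed)
qed

lemma (in group) commutator_center_mult:
  assumes z: "z \<in> group_center G" and x: "x \<in> carrier G" and y: "y \<in> carrier G"
  shows "commutator G (z \<otimes> x) y = commutator G x y"
    and "commutator G x (z \<otimes> y) = commutator G x y"
proof -
  let ?c = "commutator G x y"
  have zc: "z \<in> carrier G" using z by (rule group_centerD)
  have comm: "x \<otimes> y = y \<otimes> (x \<otimes> ?c)" using commutator_eq_iff[of x y ?c] x y by simp
  have move: "g \<otimes> (z \<otimes> h) = z \<otimes> (g \<otimes> h)" if "g \<in> carrier G" "h \<in> carrier G" for g h
    using that zc group_centerD(2)[OF z, of g] by (simp flip: m_assoc)
  show "commutator G (z \<otimes> x) y = ?c" "commutator G x (z \<otimes> y) = ?c"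
    using x y zc comm by (simp_all add: commutator_eq_iff m_assoc move)
qed

lemma (in group) commutators_conj:
  assumes "g \<in> carrier G" "c \<in> commutators G"
  shows "inv g \<otimes> c \<otimes> g \<in> commutators G"
proof -
  obtain x y where xy: "x \<in> carrier G" "y \<in> carrier G" "c = commutator G x y"
    using assms(2) by (auto simp: commutators_def)
  have "inv g \<otimes> c \<otimes> g = commutator G (inv g \<otimes> x \<otimes> g) (inv g \<otimes> y \<otimes> g)"
    using xy assms(1) by (simp add: commutator_def inv_mult_group m_assoc inv_mult_cancel)
  then show ?thesis using xy assms(1) unfolding commutators_def by blast
qed

lemma (in group) commutators_inv:
  assumes "c \<in> commutators G"
  shows "inv c \<in> commutators G"
proof -
  obtain x y where xy: "x \<in> carrier G" "y \<in> carrier G" "c = commutator G x y"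
    using assms by (auto simp: commutators_def)
  then have "inv c = commutator G y x"
    by (simp add: commutator_def inv_mult_group m_assoc)
  then show ?thesis using xy unfolding commutators_def by blast
qed

lemma (in group) finite_commutators_if_central_by_finite:
  assumes fin: "finite (rcosets (group_center G))"
  shows "finite (commutators G)"
proof -
  let ?R = "rcosets (group_center G)"
  let ?f = "\<lambda>(C, D). commutator G (SOME x. x \<in> C) (SOME y. y \<in> D)"
  have "commutators G \<subseteq> ?f ` (?R \<times> ?R)"
  proof
    fix c assume "c \<in> commutators G"
    then obtain x y where x: "x \<in> carrier G" and y: "y \<in> carrier G" and c: "c = commutator G x y"
      by (auto simp: commutators_def)
    obtain C D where C: "C \<in> ?R" "x \<in> C" and D: "D \<in> ?R" "y \<in> D"
      using x y rcosets_part_G[OF subgroup_group_center] by blast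
    have "c = ?f (C, D)"
      using center_coset_repr[OF C] center_coset_repr[OF D] c
      by (metis (no_types, lifting) case_prod_conv commutator_center_mult x)
    then show "c \<in> ?f ` (?R \<times> ?R)" using C D by blast
  qed
  then show ?thesis using fin by (auto intro: finite_subset)
qed

lemma (in group) pow_index_in_normal:
  assumes "N \<lhd> G" and x: "x \<in> carrier G"
  shows "x [^] card (rcosets N) \<in> N"
proof -
  interpret normal N G by fact
  interpret Q: group "G Mod N" by (rule factorgroup_is_group)
  have "N #> x \<in> carrier (G Mod N)" using x by (auto simp: carrier_FactGroup)
  then have "(N #> x) [^]\<^bsub>G Mod N\<^esub> Coset.order (G Mod N) = N"
    using Q.pow_order_eq_1 by simp
  moreover have "Coset.order (G Mod N) = card (rcosets N)"
    by (simp add: Coset.order_def FactGroup_def)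
  ultimately have "N #> x [^] card (rcosets N) = N"
    by (simp only: FactGroup_pow[OF x])
  then show ?thesis
    by (rule coset_join1[OF _ nat_pow_closed[OF x] subgroup_axioms])
qed

text \<open>With $c = [a,b]$ and $d = b^{-1} c b$, a direct computation gives $c d = [a, b^2]$. As $c^{n+1}$ is
central, conjugation by $b$ fixes it, so $c^{n+1} = d^{n+1}$ and
$c^{n+2} = c d^{n+1} = [a, b^2] d^n$. The right-hand side is a product of $n+1$ commutators, one
fewer than on the left.\<close>

lemma (in group) commutator_Suc_power:
  assumes a: "a \<in> carrier G" and b: "b \<in> carrier G"
    and central: "commutator G a b [^] Suc n \<in> group_center G"
  shows "commutator G a b [^] Suc (Suc n) =
    commutator G a (b \<otimes> b) \<otimes> (inv b \<otimes> commutator G a b \<otimes> b) [^] n"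
proof -
  let ?c = "commutator G a b"
  let ?d = "inv b \<otimes> ?c \<otimes> b"
  have c: "?c \<in> carrier G" and d: "?d \<in> carrier G" using a b by simp_all
  have pow: "?d [^] k = inv b \<otimes> ?c [^] k \<otimes> b" for k :: nat
    using b c by (induction k) (simp_all add: m_assoc inv_mult_cancel)
  have "?d [^] Suc n = ?c [^] Suc n"
    unfolding pow using b c group_centerD(2)[OF central b]
    by (simp add: m_assoc inv_mult_cancel del: nat_pow_Suc)
  then have "?c [^] Suc (Suc n) = ?c \<otimes> ?d [^] Suc n"
    using c by (metis nat_pow_Suc2)
  also have "\<dots> = (?c \<otimes> ?d) \<otimes> ?d [^] n"
    using c d nat_pow_Suc2[of ?d n] by (simp add: m_assoc)
  also have "?c \<otimes> ?d = commutator G a (b \<otimes> b)"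
    using a b by (simp add: commutator_def inv_mult_group m_assoc inv_mult_cancel)
  finally show ?thesis .
qed

text \<open>Schur's theorem. For $e = |G/Z(G)|$ every $e$-th power is central, so the preceding computation
writes the $(e+1)$-st power of a commutator as a product of $e$ commutators, as Dietzmann's lemma
in the above form demands.\<close>

theorem (in group) finite_generate_commutators_if_central_by_finite:
  assumes fin: "finite (rcosets (group_center G))"
  shows "finite (generate G (commutators G))"
proof -
  let ?e = "card (rcosets (group_center G))"
  have "rcosets (group_center G) \<noteq> {}"
    using subgroup.subgroup_in_rcosets[OF subgroup_group_center is_group] by blast
  then obtain n where n: "?e = Suc n"
    using fin by (metis card_gt_0_iff gr0_implies_Suc)
  have "\<exists>u. set u \<subseteq> commutators G \<and> length u \<le> ?e \<and> word_product G u = c [^] Suc ?e"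
    if c: "c \<in> commutators G" for c
  proof -
    obtain a b where ab: "a \<in> carrier G" "b \<in> carrier G" "c = commutator G a b"
      using c by (auto simp: commutators_def)
    let ?d = "inv b \<otimes> c \<otimes> b"
    let ?u = "commutator G a (b \<otimes> b) # replicate n ?d"
    have d: "?d \<in> commutators G" using commutators_conj ab(2) c by blast
    have "commutator G a (b \<otimes> b) \<in> commutators G" using ab by (auto simp: commutators_def)
    moreover have "word_product G ?u = c [^] Suc ?e"
      using commutator_Suc_power[OF ab(1,2), of n] pow_index_in_normal[OF group_center_normal, of c]
        ab n by (simp add: word_product_replicate del: nat_pow_Suc)
    ultimately show ?thesis using d n by (intro exI[of _ ?u]) auto
  qed
  then show ?thesis
    using finite_commutators_if_central_by_finite[OF fin] commutators_subset
      commutators_inv commutators_conj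
    by (intro finite_generate_if_powers_shorten) auto
qed

section \<open>Open subgroups of compact groups\<close>

lemma (in topological_group) continuous_map_mult:
  assumes "continuous_map X T f" and "continuous_map X T g"
  shows "continuous_map X T (\<lambda>x. f x \<otimes> g x)"
proof -
  have "continuous_map X T ((\<lambda>(x, y). x \<otimes> y) \<circ> (\<lambda>x. (f x, g x)))"
    using assms by (intro continuous_map_compose[OF _ continuous_mult]) (simp add: continuous_map_pairwise o_def)
  then show ?thesis by (simp add: o_def)
qed

lemma (in topological_group) continuous_map_inv:
  assumes "continuous_map X T f"
  shows "continuous_map X T (\<lambda>x. inv (f x))"
  using continuous_map_compose[OF assms continuous_inv] by (simp add: o_def)

lemma (in topological_group) openin_mult_vimage:
  assumes "openin T U" and "a \<in> carrier G"
  shows "openin T {x \<in> carrier G. x \<otimes> a \<in> U}"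
proof -
  have "continuous_map T T (\<lambda>x. x \<otimes> a)"
    using assms(2) by (intro continuous_map_mult) (simp_all add: topspace_eq)
  from openin_continuous_map_preimage[OF this assms(1)] show ?thesis
    by (simp add: topspace_eq)
qed

text \<open>If $U$ is an open subset of $H$ containing $u$, then its translate $U u^{-1} h$ is a neighborhood
of $h$ inside $H$.\<close>

lemma (in topological_group) openin_subgroup:
  assumes H: "subgroup H G" and U: "openin T U" "U \<noteq> {}" "U \<subseteq> H"
  shows "openin T H"
proof (subst openin_subopen, intro ballI)
  fix h assume h: "h \<in> H"
  interpret subgroup H G by fact
  obtain u where u: "u \<in> U" using U(2) by blast
  then have uH: "u \<in> H" using U(3) by blast
  let ?V = "{x \<in> carrier G. x \<otimes> (inv h \<otimes> u) \<in> U}"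
  have "openin T ?V"
    using h uH by (intro openin_mult_vimage[OF U(1)]) auto
  moreover have "h \<in> ?V"
    using h uH u by (simp add: inv_mult_cancel)
  moreover have "?V \<subseteq> H"
  proof
    fix x assume x: "x \<in> ?V"
    then have "x \<otimes> (inv h \<otimes> u) \<in> H" using U(3) by blast
    then have "x \<otimes> (inv h \<otimes> u) \<otimes> inv (inv h \<otimes> u) \<in> H" using h uH by simp
    then show "x \<in> H" using x h uH by (simp add: m_assoc)
  qed
  ultimately show "\<exists>V. openin T V \<and> h \<in> V \<and> V \<subseteq> H" by blast
qed

lemma (in topological_group) openin_rcoset:
  assumes H: "subgroup H G" "openin T H" and g: "g \<in> carrier G"
  shows "openin T (H #> g)"
proof -
  have "H #> g = {x \<in> carrier G. x \<otimes> inv g \<in> H}"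
    using subgroup.rcos_module[OF H(1) is_group g] subgroup.elemrcos_carrier[OF H(1) is_group g]
    by blast
  then show ?thesis using openin_mult_vimage[OF H(2), of "inv g"] g by simp
qed

text \<open>The cosets of an open subgroup form an open cover by disjoint nonempty sets, which has no proper
subcover.\<close>

lemma (in topological_group) finite_rcosets_open_subgroup:
  assumes T: "compact_space T" and H: "subgroup H G" "openin T H"
  shows "finite (rcosets H)"
proof -
  have "\<forall>C \<in> rcosets H. openin T C"
    using openin_rcoset[OF H] by (auto simp: RCOSETS_def)
  moreover have "\<Union>(rcosets H) = topspace T"
    by (simp add: rcosets_part_G[OF H(1)] topspace_eq)
  ultimately obtain F where F: "finite F" "F \<subseteq> rcosets H" "\<Union>F = carrier G"
    using T unfolding compact_space topspace_eq by (metis (no_types, lifting))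
  have "rcosets H \<subseteq> F"
  proof
    fix C assume C: "C \<in> rcosets H"
    then obtain x where x: "x \<in> C"
      using subgroup.rcosets_non_empty[OF H(1)] by blast
    moreover have "C \<subseteq> carrier G" by (rule subgroup.rcosets_carrier[OF H(1) is_group C])
    ultimately obtain D where D: "D \<in> F" "x \<in> D" using F(3) by blast
    then have "C = D"
      using rcos_disjoint[OF H(1)] C x F(2) by (metis disjnt_iff pairwiseD subsetD)
    with D show "C \<in> F" by simp
  qed
  then show ?thesis using F(1) by (rule finite_subset)
qed

lemma (in topological_group) closedin_centralizer:
  assumes "Hausdorff_space T" and "S \<subseteq> carrier G"
  shows "closedin T (centralizer G S)"
proof -
  have *: "closedin T {g \<in> topspace T. g \<otimes> s = s \<otimes> g}" if "s \<in> S" for s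
  proof (rule closedin_continuous_maps_eq[OF assms(1)])
    have const: "continuous_map T T (\<lambda>g. s)" and id: "continuous_map T T (\<lambda>g. g)"
      using assms(2) that by (auto simp: topspace_eq)
    show "continuous_map T T (\<lambda>g. g \<otimes> s)" by (rule continuous_map_mult[OF id const])
    show "continuous_map T T (\<lambda>g. s \<otimes> g)" by (rule continuous_map_mult[OF const id])
  qed
  show ?thesis
  proof (cases "S = {}")
    case True
    then show ?thesis by (simp add: centralizer_def flip: topspace_eq)
  next
    case False
    then have "centralizer G S = (\<Inter>s\<in>S. {g \<in> topspace T. g \<otimes> s = s \<otimes> g})"
      by (auto simp: centralizer_def topspace_eq)
    then show ?thesis using False * by (simp only:) (intro closedin_Inter; blast)
  qed
qed

section \<open>Countable abelian covers and Baire category\<close>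

text \<open>Replace each covering subgroup by its double centralizer, which is closed and abelian. By the Baire
category theorem the union of those that are open meets every nonempty open set. Fix an open one,
$A$. Each of its finitely many cosets is open, and so meets an open abelian $B$ of the cover. The
intersection of $A$ and these $B$ is an open subgroup commuting with $A$ and with a representative
of each coset of $A$, that is, with all of $G$.\<close>

lemma (in topological_group) open_center_if_countable_abelian_cover:
  assumes T: "compact_space T" "Hausdorff_space T"
    and cover: "covered_by_countably_many_abelian_subgroups G"
  shows "openin T (group_center G)"
proof -
  obtain \<F> where "countable \<F> \<and> (\<forall>H\<in>\<F>. Defs.abelian_subgroup H G) \<and> \<Union>\<F> = carrier G"
    using cover unfolding covered_by_countably_many_abelian_subgroups_def ..
  then have F: "countable \<F>" "\<And>H. H \<in> \<F> \<Longrightarrow> Defs.abelian_subgroup H G" "\<Union>\<F> = carrier G"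
    by simp_all
  let ?C = "\<lambda>H. centralizer G (centralizer G H)"
  define \<B> where "\<B> = ?C ` \<F>"
  define \<O> where "\<O> = {B \<in> \<B>. openin T B}"
  have sub: "H \<subseteq> carrier G" if "H \<in> \<F>" for H using F(3) that by blast
  have ab: "Defs.abelian_subgroup B G" and clo: "closedin T B" if B: "B \<in> \<B>" for B
  proof -
    obtain H where H: "H \<in> \<F>" "B = ?C H" using B by (auto simp: \<B>_def)
    show "Defs.abelian_subgroup B G"
      unfolding H(2) using sub[OF H(1)] abelian_subgroupD(2)[OF F(2)[OF H(1)]]
      by (rule abelian_bicentralizer)
    show "closedin T B"
      unfolding H(2) by (rule closedin_centralizer[OF T(2)]) (auto simp: centralizer_def)
  qed
  have "H \<subseteq> ?C H" if "H \<in> \<F>" for H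
    using sub[OF that] abelian_subgroupD(2)[OF F(2)[OF that]] by (rule abelian_bicentralizer)
  then have cov: "carrier G \<subseteq> \<Union>\<B>" using F(3) unfolding \<B>_def by blast
  have subO: "subgroup B G" if "B \<in> \<O>" for B
    using that ab abelian_subgroupD(1) by (auto simp: \<O>_def)
  \<comment> \<open>Members of \<open>\<B>\<close> that are not open have empty interior, hence so does their union; an open set
    that avoids all open members would lie in that union.\<close>
  have dense: "U \<inter> \<Union>\<O> \<noteq> {}" if U: "openin T U" "U \<noteq> {}" for U
  proof
    assume disj: "U \<inter> \<Union>\<O> = {}"
    have "T interior_of B = {}" if "B \<in> \<B> - \<O>" for B
      using that openin_subgroup[OF abelian_subgroupD(1)[OF ab], of B "T interior_of B"]
      by (auto simp: \<O>_def interior_of_subset)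
    moreover have "countable (\<B> - \<O>)" using F(1) by (simp add: \<B>_def)
    moreover have "locally_compact_space T \<and> regular_space T"
      using T by (simp add: compact_imp_locally_compact_space compact_Hausdorff_imp_regular_space)
    ultimately have "T interior_of \<Union>(\<B> - \<O>) = {}"
      using clo by (intro Baire_category_alt) auto
    moreover have "U \<subseteq> \<Union>(\<B> - \<O>)"
      using disj cov openin_subset[OF U(1)] unfolding topspace_eq by blast
    ultimately show False using U interior_of_maximal by blast
  qed
  have "openin T (carrier G)" by (simp flip: topspace_eq)
  then obtain A where A: "A \<in> \<O>" using dense[of "carrier G"] one_closed by blast
  then have A': "subgroup A G" "openin T A" using subO by (auto simp: \<O>_def)
  have finA: "finite (rcosets A)" by (rule finite_rcosets_open_subgroup[OF T(1) A'])
  have "\<exists>B\<in>\<O>. C \<inter> B \<noteq> {}" if "C \<in> rcosets A" for C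
  proof -
    have "openin T C" using that openin_rcoset[OF A'] by (auto simp: RCOSETS_def)
    then show ?thesis using dense subgroup.rcosets_non_empty[OF A'(1) that] by blast
  qed
  then obtain f where f: "\<And>C. C \<in> rcosets A \<Longrightarrow> f C \<in> \<O> \<and> C \<inter> f C \<noteq> {}" by metis
  \<comment> \<open>\<open>f C\<close> is an open abelian subgroup in which a representative of the coset \<open>C\<close> can be found.\<close>
  define \<N> where "\<N> = insert A (f ` (rcosets A))"
  have N: "\<N> \<subseteq> \<O>" "finite \<N>" "\<N> \<noteq> {}" using A f finA by (auto simp: \<N>_def)
  have "openin T (\<Inter>\<N>)" using N by (intro openin_Inter) (auto simp: \<O>_def)
  moreover have "\<one> \<in> \<Inter>\<N>" using N subO subgroup.one_closed by blast
  moreover have "\<Inter>\<N> \<subseteq> group_center G"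
  proof
    fix x assume x: "x \<in> \<Inter>\<N>"
    have commute: "x \<otimes> y = y \<otimes> x" if "B \<in> \<N>" "y \<in> B" for B y
      using that x N(1) ab abelian_subgroupD(2) by (fastforce simp: \<O>_def)
    have xc: "x \<in> carrier G" using x A'(1) subgroup.subset by (fastforce simp: \<N>_def)
    show "x \<in> group_center G"
    proof (rule group_centerI[OF xc])
      fix g assume g: "g \<in> carrier G"
      let ?C = "A #> g"
      have C: "?C \<in> rcosets A" using g subgroup.subset[OF A'(1)] by (intro rcosetsI)
      then obtain y where y: "y \<in> ?C" "y \<in> f ?C" using f by blast
      have "A #> y = ?C" using repr_independence[OF y(1) g A'(1)] by simp
      then obtain a where a: "a \<in> A" "g = a \<otimes> y"
        using rcos_self[OF g A'(1)] by (auto simp: r_coset_def)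
      have ac: "a \<in> carrier G" and yc: "y \<in> carrier G"
        using a(1) subgroup.subset[OF A'(1)] subgroup.elemrcos_carrier[OF A'(1) is_group g y(1)] by auto
      have "x \<otimes> a = a \<otimes> x" using a by (intro commute[of A]) (auto simp: \<N>_def)
      moreover have "x \<otimes> y = y \<otimes> x" using y C by (intro commute[of "f ?C"]) (auto simp: \<N>_def)
      ultimately show "x \<otimes> g = g \<otimes> x"
        unfolding a(2) using ac yc xc by (metis m_assoc)
    qed
  qed
  ultimately show ?thesis
    using openin_subgroup[OF subgroup_group_center] by blast
qed

section \<open>Finite commutator subgroups\<close>

lemma (in topological_group) commutators_subset_commutator_subgroup:
  "commutators G \<subseteq> commutator_subgroup G T"
  by (auto simp: commutators_def commutator_subgroup_def closed_subgroup_generated_def)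

text \<open>Since the set of commutators is finite, the pairs with trivial commutator form an open subset of
$G \times G$. It contains $G \times \{1\}$, so by compactness of $G$ the tube lemma yields a
neighborhood $V$ of $1$ with $G \times V$ inside it. Then $V$ is central.\<close>

lemma (in topological_group) open_center_if_finite_commutators:
  assumes T: "compact_space T" "Hausdorff_space T" and fin: "finite (commutators G)"
  shows "openin T (group_center G)"
proof -
  let ?P = "prod_topology T T"
  let ?c = "\<lambda>p. commutator G (fst p) (snd p)"
  have cont: "continuous_map ?P T ?c"
    unfolding commutator_def
    by (intro continuous_map_mult continuous_map_inv continuous_map_fst continuous_map_snd)
  \<comment> \<open>A neighborhood of \<open>\<one>\<close> that contains no other commutator.\<close>
  have "openin T (carrier G - (commutators G - {\<one>}))"
    using fin commutators_subset closedin_Hausdorff_finite[OF T(2), of "commutators G - {\<one>}"]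
    by (auto simp: closedin_def topspace_eq)
  from openin_continuous_map_preimage[OF cont this]
  have "openin ?P {p \<in> topspace ?P. ?c p \<in> carrier G - (commutators G - {\<one>})}" .
  moreover have "{p \<in> topspace ?P. ?c p \<in> carrier G - (commutators G - {\<one>})} =
      {p \<in> topspace ?P. ?c p = \<one>}"
    by (auto simp: topspace_eq commutators_def)
  ultimately have "openin ?P {p \<in> topspace ?P. ?c p = \<one>}" by simp
  moreover have "compactin T (carrier G)" using T(1) by (simp add: compact_space_def topspace_eq)
  moreover have "carrier G \<times> {\<one>} \<subseteq> {p \<in> topspace ?P. ?c p = \<one>}"
    by (auto simp: topspace_eq commutator_eq_iff)
  moreover have "\<one> \<in> topspace T" by (simp add: topspace_eq)
  ultimately have "\<exists>U V. openin T U \<and> openin T V \<and> carrier G \<subseteq> U \<and> \<one> \<in> V \<and>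
      U \<times> V \<subseteq> {p \<in> topspace ?P. ?c p = \<one>}"
    by (intro tube_lemma_left)
  then obtain U V where UV: "openin T V" "carrier G \<subseteq> U" "\<one> \<in> V"
      "U \<times> V \<subseteq> {p \<in> topspace ?P. ?c p = \<one>}"
    by blast
  have "V \<subseteq> group_center G"
  proof
    fix v assume v: "v \<in> V"
    then have vc: "v \<in> carrier G" using openin_subset[OF UV(1)] by (auto simp: topspace_eq)
    have "commutator G g v = \<one>" if "g \<in> carrier G" for g
    proof -
      have "(g, v) \<in> U \<times> V" using UV(2) v that by blast
      then show ?thesis using UV(4) by auto
    qed
    then show "v \<in> group_center G" using vc by (auto simp: commutator_eq_iff intro!: group_centerI)
  qed
  then show ?thesis using openin_subgroup[OF subgroup_group_center UV(1)] UV(3) by blast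
qed

text \<open>By Schur's theorem the commutators generate a finite subgroup in the abstract sense; in a Hausdorff
group it is closed, so it already contains the closed subgroup that they generate.\<close>

lemma (in topological_group) finite_commutator_subgroup_if_central_by_finite:
  assumes "Hausdorff_space T" and "finite (rcosets (group_center G))"
  shows "finite (commutator_subgroup G T)"
proof -
  let ?D = "generate G (commutators G)"
  have fin: "finite ?D" by (rule finite_generate_commutators_if_central_by_finite[OF assms(2)])
  have D: "subgroup ?D G" by (rule generate_is_subgroup[OF commutators_subset])
  have "closedin T ?D"
    using closedin_Hausdorff_finite[OF assms(1) _ fin] subgroup.subset[OF D] by (simp add: topspace_eq)
  moreover have "commutators G \<subseteq> ?D" by (auto intro: generate.incl)
  ultimately have "commutator_subgroup G T \<subseteq> ?D"
    using D by (auto simp: commutator_subgroup_def closed_subgroup_generated_def simp flip: commutators_def)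
  then show ?thesis using fin by (rule finite_subset)
qed

theorem theorem1p1:
  fixes G :: "('a, 'b) monoid_scheme" and T :: "'a topology"
  assumes "profinite_group G T"
  shows "(covered_by_countably_many_abelian_subgroups G
            \<longleftrightarrow> finite (commutator_subgroup G T))
       \<and> (finite (commutator_subgroup G T)
            \<longleftrightarrow> finite (carrier (G Mod group_center G)))"
proof -
  interpret profinite_group G T by fact
  have index: "carrier (G Mod group_center G) = rcosets\<^bsub>G\<^esub> (group_center G)"
    by (simp add: FactGroup_def)
  have open_index: "finite (rcosets\<^bsub>G\<^esub> (group_center G))" if "openin T (group_center G)"
    using finite_rcosets_open_subgroup[OF compact subgroup_group_center that] .
  have "finite (rcosets\<^bsub>G\<^esub> (group_center G))" if "covered_by_countably_many_abelian_subgroups G"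
    using open_center_if_countable_abelian_cover[OF compact Hausdorff that] by (rule open_index)
  moreover have "finite (rcosets\<^bsub>G\<^esub> (group_center G))" if "finite (commutator_subgroup G T)"
    using open_center_if_finite_commutators[OF compact Hausdorff
        finite_subset[OF commutators_subset_commutator_subgroup that]]
    by (rule open_index)
  ultimately show ?thesis
    unfolding index
    using countable_abelian_cover_if_central_by_finite
      finite_commutator_subgroup_if_central_by_finite[OF Hausdorff] by blast
qed

end
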